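(* Let $d=(d_n)_{n\ge0}$ be a monotonic increasing, unbounded sequence of positive real numbers. Then $\mathscr M(bs_d)\supseteq\ell^1$.
   Context: All sequences are complex and indexed by $\mathbb N_0=\{0,1,2,\dots\}$. $bs_d=\{x\in\mathbb C^{\mathbb N_0}:\|x\|_{bs_d}=\sup_m\frac1{d_m}|\sum_{k=0}^m x_k|<\infty\}$. The convolution is $(a*x)_n=\sum_{k=0}^n a_{n-k}x_k$. The multiplier of a sequence space $X$ is $\mathscr M(X)=\{a\in\mathbb C^{\mathbb N_0}: a*x\in X\text{ for all }x\in X\}$. $\ell^1$ is the space of absolutely summable sequences. *)

theory Defs
  imports "HOL-Analysis.Analysis"
begin

text \<open>The norm is taken in the extended reals, where the supremum always exists; the value is
  \<open>\<infinity>\<close> exactly when the weighted partial sums are unbounded.\<close>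

definition bs_norm :: "(nat \<Rightarrow> real) \<Rightarrow> (nat \<Rightarrow> complex) \<Rightarrow> ereal" where
  "bs_norm d x = (SUP m. ereal (1 / d m * cmod (\<Sum>k\<le>m. x k)))"

definition bs :: "(nat \<Rightarrow> real) \<Rightarrow> (nat \<Rightarrow> complex) set" where
  "bs d = {x. bs_norm d x < \<infinity>}"

definition convolution :: "(nat \<Rightarrow> complex) \<Rightarrow> (nat \<Rightarrow> complex) \<Rightarrow> nat \<Rightarrow> complex" where
  "convolution a x n = (\<Sum>k\<le>n. a (n - k) * x k)"

definition multiplier :: "(nat \<Rightarrow> complex) set \<Rightarrow> (nat \<Rightarrow> complex) set" where
  "multiplier X = {a. \<forall>x\<in>X. convolution a x \<in> X}"

definition ell1 :: "(nat \<Rightarrow> complex) set" where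
  "ell1 = {a. summable (\<lambda>n. cmod (a n))}"

end

theory Submission
  imports Defs
begin

text \<open>Write \<open>S_m(x)\<close> for the partial sums of \<open>x\<close>. Those of
  \<open>a * x\<close> are themselves a convolution,
  \<open>S_m(a * x) = \<Sum>j\<le>m. a_j S_{m-j}(x)\<close> (\<open>sum_convolution\<close>). If
  \<open>|S_k(x)| \<le> M d_k\<close> for all \<open>k\<close>, then monotonicity of
  \<open>d\<close> bounds every \<open>|S_{m-j}(x)|\<close> by \<open>M d_m\<close>, so
  \<open>|S_m(a * x)|\<close> is at most \<open>M d_m\<close> times the \<open>ell1\<close> norm of
  \<open>a\<close>. \<open>mem_bs_iff\<close> turns the extended-real norm condition into such
  bounds.\<close>

lemma mem_bs_iff:
  assumes "\<And>n. d n > 0"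
  shows "x \<in> bs d \<longleftrightarrow> (\<exists>M. \<forall>m. cmod (\<Sum>k\<le>m. x k) \<le> M * d m)"
proof
  assume "x \<in> bs d"
  then have fin: "bs_norm d x < \<infinity>"
    by (simp add: bs_def)
  have le: "ereal (1 / d m * cmod (\<Sum>k\<le>m. x k)) \<le> bs_norm d x" for m
    unfolding bs_norm_def by (rule SUP_upper) simp
  \<comment> \<open>The supremum is not \<open>-\<infinity>\<close> because it dominates the real
    term at index 0.\<close>
  obtain M where "bs_norm d x = ereal M"
    using fin le[of 0] by (cases "bs_norm d x") auto
  with le have "cmod (\<Sum>k\<le>m. x k) / d m \<le> M" for m
    by simp
  then show "\<exists>M. \<forall>m. cmod (\<Sum>k\<le>m. x k) \<le> M * d m"
    using assms by (auto simp: pos_divide_le_eq)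
next
  assume "\<exists>M. \<forall>m. cmod (\<Sum>k\<le>m. x k) \<le> M * d m"
  then obtain M where "\<And>m. cmod (\<Sum>k\<le>m. x k) / d m \<le> M"
    using assms by (auto simp: pos_divide_le_eq)
  then have "bs_norm d x \<le> ereal M"
    unfolding bs_norm_def by (intro SUP_least) simp
  then show "x \<in> bs d"
    by (auto simp: bs_def)
qed

text \<open>Taking partial sums is convolution with the constant sequence 1, so this is
  associativity of convolution.\<close>

lemma sum_convolution:
  "(\<Sum>n\<le>m. convolution a x n) = (\<Sum>j\<le>m. a j * (\<Sum>k\<le>m - j. x k))"
proof (induction m)
  case (Suc m)
  \<comment> \<open>Each inner sum with \<open>j \<le> m\<close> gains the one term
    \<open>x (Suc m - j)\<close>; together with \<open>a (Suc m) * x 0\<close> these new terms form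
    entry \<open>Suc m\<close> of the convolution.\<close>
  have "(\<Sum>j\<le>Suc m. a j * (\<Sum>k\<le>Suc m - j. x k))
      = (\<Sum>j\<le>m. a j * (\<Sum>k\<le>m - j. x k) + a j * x (Suc m - j)) + a (Suc m) * x 0"
    by (simp add: Suc_diff_le ring_distribs)
  also have "\<dots> = (\<Sum>n\<le>m. convolution a x n) + (\<Sum>j\<le>Suc m. a j * x (Suc m - j))"
    by (simp add: Suc sum.distrib)
  also have "(\<Sum>j\<le>Suc m. a j * x (Suc m - j)) = convolution a x (Suc m)"
    unfolding convolution_def by (rule sum.reindex_bij_witness[of _ "\<lambda>k. Suc m - k" "\<lambda>k. Suc m - k"]) auto
  finally show ?case
    by simp
qed (simp add: convolution_def)

theorem theorem5p5:
  fixes d :: "nat \<Rightarrow> real"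
  assumes "incseq d"
    and "\<not> bdd_above (range d)"
    and "\<And>n. d n > 0"
  shows "multiplier (bs d) \<supseteq> ell1"
proof
  fix a assume "a \<in> ell1"
  then have a: "summable (\<lambda>n. cmod (a n))"
    by (simp add: ell1_def)
  have "convolution a x \<in> bs d" if "x \<in> bs d" for x
  proof -
    obtain M where M: "\<And>m. cmod (\<Sum>k\<le>m. x k) \<le> M * d m"
      using \<open>x \<in> bs d\<close> mem_bs_iff[of d x] assms(3) by auto
    \<comment> \<open>The sign of \<open>M\<close> is needed to multiply the inequality
      \<open>d (m - j) \<le> d m\<close> by it.\<close>
    have "0 \<le> M * d 0"
      using M[of 0] norm_ge_zero order_trans by blast
    then have "0 \<le> M"
      using assms(3)[of 0] by (simp add: zero_le_mult_iff)
    have "cmod (\<Sum>n\<le>m. convolution a x n) \<le> ((\<Sum>j. cmod (a j)) * M) * d m" for m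
    proof -
      have "cmod (\<Sum>n\<le>m. convolution a x n) \<le> (\<Sum>j\<le>m. cmod (a j) * (M * d m))"
        unfolding sum_convolution
      proof (rule sum_norm_le)
        fix j
        \<comment> \<open>The resulting bound is independent of \<open>j\<close>, so it factors out
          of the sum.\<close>
        have "M * d (m - j) \<le> M * d m"
          using \<open>0 \<le> M\<close> incseqD[OF assms(1), of "m - j" m] by (simp add: mult_left_mono)
        with M[of "m - j"] show "cmod (a j * (\<Sum>k\<le>m - j. x k)) \<le> cmod (a j) * (M * d m)"
          unfolding norm_mult by (intro mult_left_mono) auto
      qed
      also have "\<dots> = (\<Sum>j\<le>m. cmod (a j)) * (M * d m)"
        by (simp add: sum_distrib_right)
      \<comment> \<open>Passing to the full series makes the constant independent of
        \<open>m\<close>.\<close>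
      also have "\<dots> \<le> (\<Sum>j. cmod (a j)) * (M * d m)"
        using \<open>0 \<le> M\<close> assms(3)[of m] by (intro mult_right_mono sum_le_suminf a) auto
      finally show ?thesis
        by (simp add: mult.assoc)
    qed
    then show ?thesis
      using mem_bs_iff[of d "convolution a x"] assms(3) by blast
  qed
  then show "a \<in> multiplier (bs d)"
    by (simp add: multiplier_def)
qed

end
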